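(* Let $K$ be an NIP expansion of a field, and let $\tau$ be a definable ring topology on $K$. Then $\tau$ is a field topology, i.e., division is continuous with respect to $\tau$.
   Context: A ring topology (respectively field topology) on a field $K$ is a Hausdorff, non-discrete topology on $K$ for which the ring operations $+,-,\cdot$ (respectively the field operations, including division) are continuous. An NIP expansion of a field is a first-order structure $(K,+,\cdot,\ldots)$ expanding a field $(K,+,\cdot)$ whose complete theory is NIP. "Definable" means definable with parameters. A topology on a definable set is definable if some uniformly definable family of sets is a basis of open sets. *)

theory Defs
  imports "HOL-Analysis.Analysis"
begin

section \<open>First-order logic\<close>

text \<open>
  A language is given by its function and relation symbols together with their arities; constants are
  function symbols of arity \<open>0\<close>. Equality is logical. The universe of a structure is its whole
  carrier type, and \<open>Fun M f\<close>, \<open>Rel M r\<close> are only meaningful on lists whose length is an arity of the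
  symbol. Formulas use de Bruijn indices: below a quantifier, variable \<open>0\<close> is the bound one
  and \<open>Suc v\<close> is the outer variable \<open>v\<close>.
\<close>

record ('f, 'r) lang =
  Funs :: "('f \<times> nat) set"
  Rels :: "('r \<times> nat) set"

record ('a, 'f, 'r) fo_struct =
  Fun :: "'f \<Rightarrow> 'a list \<Rightarrow> 'a"
  Rel :: "'r \<Rightarrow> 'a list \<Rightarrow> bool"

datatype 'f tm = Var nat | App 'f "'f tm list"

datatype ('f, 'r) fm =
    FTrue
  | FEq "'f tm" "'f tm"
  | FRel 'r "'f tm list"
  | FNot "('f, 'r) fm"
  | FAnd "('f, 'r) fm" "('f, 'r) fm"
  | FEx "('f, 'r) fm"

fun wf_tm :: "('f, 'r) lang \<Rightarrow> 'f tm \<Rightarrow> bool" where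
  "wf_tm L (Var v) = True"
| "wf_tm L (App f ts) = ((f, length ts) \<in> Funs L \<and> (\<forall>t\<in>set ts. wf_tm L t))"

fun wf_fm :: "('f, 'r) lang \<Rightarrow> ('f, 'r) fm \<Rightarrow> bool" where
  "wf_fm L FTrue = True"
| "wf_fm L (FEq s t) = (wf_tm L s \<and> wf_tm L t)"
| "wf_fm L (FRel r ts) = ((r, length ts) \<in> Rels L \<and> (\<forall>t\<in>set ts. wf_tm L t))"
| "wf_fm L (FNot \<phi>) = wf_fm L \<phi>"
| "wf_fm L (FAnd \<phi> \<psi>) = (wf_fm L \<phi> \<and> wf_fm L \<psi>)"
| "wf_fm L (FEx \<phi>) = wf_fm L \<phi>"

fun fv_tm :: "'f tm \<Rightarrow> nat set" where
  "fv_tm (Var v) = {v}"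
| "fv_tm (App f ts) = (\<Union>t\<in>set ts. fv_tm t)"

fun fv :: "('f, 'r) fm \<Rightarrow> nat set" where
  "fv FTrue = {}"
| "fv (FEq s t) = fv_tm s \<union> fv_tm t"
| "fv (FRel r ts) = (\<Union>t\<in>set ts. fv_tm t)"
| "fv (FNot \<phi>) = fv \<phi>"
| "fv (FAnd \<phi> \<psi>) = fv \<phi> \<union> fv \<psi>"
| "fv (FEx \<phi>) = {v. Suc v \<in> fv \<phi>}"

fun eval :: "('a, 'f, 'r) fo_struct \<Rightarrow> (nat \<Rightarrow> 'a) \<Rightarrow> 'f tm \<Rightarrow> 'a" where
  "eval M e (Var v) = e v"
| "eval M e (App f ts) = Fun M f (map (eval M e) ts)"

fun sat :: "('a, 'f, 'r) fo_struct \<Rightarrow> (nat \<Rightarrow> 'a) \<Rightarrow> ('f, 'r) fm \<Rightarrow> bool" where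
  "sat M e FTrue = True"
| "sat M e (FEq s t) = (eval M e s = eval M e t)"
| "sat M e (FRel r ts) = Rel M r (map (eval M e) ts)"
| "sat M e (FNot \<phi>) = (\<not> sat M e \<phi>)"
| "sat M e (FAnd \<phi> \<psi>) = (sat M e \<phi> \<and> sat M e \<psi>)"
| "sat M e (FEx \<phi>) = (\<exists>a. sat M (case_nat a e) \<phi>)"

text \<open>
  \<open>holds M \<phi> [a\<^sub>0, \<dots>, a\<^sub>n\<^sub>-\<^sub>1]\<close> is \<open>M \<Turnstile> \<phi>(a\<^sub>0, \<dots>, a\<^sub>n\<^sub>-\<^sub>1)\<close>; it is only
  used for \<open>fv \<phi> \<subseteq> {..<n}\<close>, where the unspecified values of \<open>(!)\<close> beyond the end of the list do
  not matter.
\<close>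

definition holds :: "('a, 'f, 'r) fo_struct \<Rightarrow> ('f, 'r) fm \<Rightarrow> 'a list \<Rightarrow> bool" where
  "holds M \<phi> as = sat M ((!) as) \<phi>"

definition complete_theory ::
    "('f, 'r) lang \<Rightarrow> ('a, 'f, 'r) fo_struct \<Rightarrow> ('f, 'r) fm set" where
  "complete_theory L M = {\<phi>. wf_fm L \<phi> \<and> fv \<phi> = {} \<and> (\<forall>e. sat M e \<phi>)}"

fun ren_tm :: "(nat \<Rightarrow> nat) \<Rightarrow> 'f tm \<Rightarrow> 'f tm" where
  "ren_tm \<rho> (Var v) = Var (\<rho> v)"
| "ren_tm \<rho> (App f ts) = App f (map (ren_tm \<rho>) ts)"

fun ren :: "(nat \<Rightarrow> nat) \<Rightarrow> ('f, 'r) fm \<Rightarrow> ('f, 'r) fm" where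
  "ren \<rho> FTrue = FTrue"
| "ren \<rho> (FEq s t) = FEq (ren_tm \<rho> s) (ren_tm \<rho> t)"
| "ren \<rho> (FRel r ts) = FRel r (map (ren_tm \<rho>) ts)"
| "ren \<rho> (FNot \<phi>) = FNot (ren \<rho> \<phi>)"
| "ren \<rho> (FAnd \<phi> \<psi>) = FAnd (ren \<rho> \<phi>) (ren \<rho> \<psi>)"
| "ren \<rho> (FEx \<phi>) = FEx (ren (case_nat 0 (\<lambda>v. Suc (\<rho> v))) \<phi>)"


section \<open>NIP theories\<close>

text \<open>
  A partitioned formula \<open>\<phi>(x; y)\<close> with \<open>|x| = m\<close> and \<open>|y| = k\<close> has free variables among
  \<open>0, \<dots>, m + k - 1\<close>, the first \<open>m\<close> of them being \<open>x\<close>. The sentence \<open>shatter_fm m k n \<phi>\<close> says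
  \<^item> there are \<open>m\<close>-tuples \<open>x\<^sub>i\<close> (\<open>i < n\<close>) and \<open>k\<close>-tuples \<open>y\<^sub>S\<close> (\<open>S \<subseteq> {..<n}\<close>) such that, for all
    \<open>i\<close> and \<open>S\<close>, \<open>\<phi>(x\<^sub>i; y\<^sub>S)\<close> holds if and only if \<open>i \<in> S\<close>.

  The set \<open>S\<close> is coded by the number \<open>s < 2 ^ n\<close> with binary digits \<open>bit s i \<longleftrightarrow> i \<in> S\<close>; the function
  \<open>shatter_var\<close> renames the variables of \<open>\<phi>(x; y)\<close> to those of \<open>\<phi>(x\<^sub>i; y\<^sub>S)\<close>. See
  \<open>shatter_fm_in_theory_iff\<close> below.
\<close>

definition shatter_var :: "nat \<Rightarrow> nat \<Rightarrow> nat \<Rightarrow> nat \<Rightarrow> nat \<Rightarrow> nat \<Rightarrow> nat" where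
  "shatter_var m k n i s v = (if v < m then i * m + v else n * m + s * k + (v - m))"

definition shatter_fm :: "nat \<Rightarrow> nat \<Rightarrow> nat \<Rightarrow> ('f, 'r) fm \<Rightarrow> ('f, 'r) fm" where
  "shatter_fm m k n \<phi> =
     (FEx ^^ (n * m + 2 ^ n * k))
       (foldr FAnd
         [let \<psi> = ren (shatter_var m k n i s) \<phi> in if bit s i then \<psi> else FNot \<psi>.
            i \<leftarrow> [0..<n], s \<leftarrow> [0..<2 ^ n]]
         FTrue)"

text \<open>
  The formula \<open>\<phi>(x; y)\<close> has the independence property in the complete theory \<open>T\<close> if \<open>T\<close> entails,
  that is, contains, these sentences for all \<open>n\<close>; \<open>T\<close> is NIP if no formula has it. By compactness, this
  agrees with the variant asking for an infinite shattered set in some model of \<open>T\<close>.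
\<close>

definition has_IP :: "('f, 'r) fm set \<Rightarrow> nat \<Rightarrow> nat \<Rightarrow> ('f, 'r) fm \<Rightarrow> bool" where
  "has_IP T m k \<phi> \<longleftrightarrow> (\<forall>n. shatter_fm m k n \<phi> \<in> T)"

definition NIP :: "('f, 'r) lang \<Rightarrow> ('f, 'r) fm set \<Rightarrow> bool" where
  "NIP L T \<longleftrightarrow> (\<forall>m k \<phi>. wf_fm L \<phi> \<and> fv \<phi> \<subseteq> {..<m + k} \<longrightarrow> \<not> has_IP T m k \<phi>)"

lemma eval_cong: "(\<And>v. v \<in> fv_tm t \<Longrightarrow> e v = e' v) \<Longrightarrow> eval M e t = eval M e' t"
proof (induction t)
  case (App f ts)
  then have "map (eval M e) ts = map (eval M e') ts" by (intro map_cong refl) auto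
  then show ?case by (simp only: eval.simps)
qed simp

lemma sat_cong: "(\<And>v. v \<in> fv \<phi> \<Longrightarrow> e v = e' v) \<Longrightarrow> sat M e \<phi> = sat M e' \<phi>"
proof (induction \<phi> arbitrary: e e')
  case (FEq s t)
  then show ?case using eval_cong[of s e e' M] eval_cong[of t e e' M] by auto
next
  case (FRel r ts)
  then have "map (eval M e) ts = map (eval M e') ts" by (intro map_cong refl eval_cong) auto
  then show ?case by (simp only: sat.simps)
next
  case (FNot \<phi>)
  then show ?case by (metis fv.simps(4) sat.simps(4))
next
  case (FAnd \<phi> \<psi>)
  then show ?case by (metis UnCI fv.simps(5) sat.simps(5))
next
  case (FEx \<phi>)
  have "sat M (case_nat a e) \<phi> = sat M (case_nat a e') \<phi>" for a
    by (rule FEx.IH) (use FEx.prems in \<open>auto split: nat.split\<close>)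
  then show ?case by simp
qed simp

lemma eval_ren: "eval M e (ren_tm \<rho> t) = eval M (\<lambda>v. e (\<rho> v)) t"
  by (induction t) (auto simp: comp_def intro!: arg_cong[where f = "Fun M _"])

lemma sat_ren: "sat M e (ren \<rho> \<phi>) = sat M (\<lambda>v. e (\<rho> v)) \<phi>"
proof (induction \<phi> arbitrary: e \<rho>)
  case (FEx \<phi>)
  have "(\<lambda>v. case_nat a e (case_nat 0 (\<lambda>v. Suc (\<rho> v)) v)) = case_nat a (\<lambda>v. e (\<rho> v))" for a
    by (auto split: nat.split)
  then show ?case by (simp add: FEx.IH)
qed (simp_all add: eval_ren comp_def)

lemma fv_ren_tm: "fv_tm (ren_tm \<rho> t) = \<rho> ` fv_tm t"
  by (induction t) auto

lemma fv_ren: "fv (ren \<rho> \<phi>) = \<rho> ` fv \<phi>"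
proof (induction \<phi> arbitrary: \<rho>)
  case (FEx \<phi>)
  have "Suc w \<in> case_nat 0 (\<lambda>v. Suc (\<rho> v)) ` A \<longleftrightarrow> (\<exists>v. Suc v \<in> A \<and> w = \<rho> v)" for w A
  proof
    assume "Suc w \<in> case_nat 0 (\<lambda>v. Suc (\<rho> v)) ` A"
    then obtain u where "u \<in> A" "Suc w = case_nat 0 (\<lambda>v. Suc (\<rho> v)) u" by blast
    then show "\<exists>v. Suc v \<in> A \<and> w = \<rho> v" by (cases u) auto
  next
    assume "\<exists>v. Suc v \<in> A \<and> w = \<rho> v"
    then obtain v where "Suc v \<in> A" "w = \<rho> v" by blast
    then show "Suc w \<in> case_nat 0 (\<lambda>v. Suc (\<rho> v)) ` A"
      by (intro image_eqI[of _ _ "Suc v"]) simp_all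
  qed
  then show ?case by (auto simp: FEx.IH)
qed (auto simp: fv_ren_tm)

lemma wf_ren_tm: "wf_tm L (ren_tm \<rho> t) = wf_tm L t"
  by (induction t) auto

lemma wf_ren: "wf_fm L (ren \<rho> \<phi>) = wf_fm L \<phi>"
  by (induction \<phi> arbitrary: \<rho>) (auto simp: wf_ren_tm)

lemma wf_Ex_pow: "wf_fm L ((FEx ^^ N) \<phi>) = wf_fm L \<phi>"
  by (induction N) auto

lemma fv_Ex_pow: "fv ((FEx ^^ N) \<phi>) = {v. v + N \<in> fv \<phi>}"
  by (induction N) auto

lemma sat_Ex_pow: "sat M e ((FEx ^^ N) \<phi>) \<longleftrightarrow> (\<exists>e'. (\<forall>v. e' (v + N) = e v) \<and> sat M e' \<phi>)"
proof (induction N arbitrary: e)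
  case 0
  have "(\<forall>v. e' v = e v) \<longleftrightarrow> e' = e" for e' :: "nat \<Rightarrow> 'a" by auto
  then show ?case by simp
next
  case (Suc N)
  have "(\<exists>a. \<forall>v. e' (v + N) = case_nat a e v) \<longleftrightarrow> (\<forall>v. e' (v + Suc N) = e v)" for e'
    by (auto split: nat.split)
  then have "(\<exists>a e'. (\<forall>v. e' (v + N) = case_nat a e v) \<and> sat M e' \<phi>) \<longleftrightarrow>
      (\<exists>e'. (\<forall>v. e' (v + Suc N) = e v) \<and> sat M e' \<phi>)" by blast
  then show ?case by (simp only: funpow.simps comp_apply sat.simps Suc.IH)
qed

lemma conj_simps:
  "wf_fm L (foldr FAnd \<phi>s FTrue) \<longleftrightarrow> (\<forall>\<phi>\<in>set \<phi>s. wf_fm L \<phi>)"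
  "fv (foldr FAnd \<phi>s FTrue) = (\<Union>\<phi>\<in>set \<phi>s. fv \<phi>)"
  "sat M e (foldr FAnd \<phi>s FTrue) \<longleftrightarrow> (\<forall>\<phi>\<in>set \<phi>s. sat M e \<phi>)"
  by (induction \<phi>s) auto

lemma ball_grid: "(\<forall>x\<in>set [f i s. i \<leftarrow> [0..<n], s \<leftarrow> [0..<N]]. P x) \<longleftrightarrow> (\<forall>i<n. \<forall>s<N. P (f i s))"
  by auto

lemma shatter_var_less:
  assumes "i < n" "s < 2 ^ n" "v < m + k"
  shows "shatter_var m k n i s v < n * m + 2 ^ n * k"
proof (cases "v < m")
  case True
  have "i * m + v < Suc i * m" using True by simp
  also have "\<dots> \<le> n * m" using assms(1) by (intro mult_le_mono1) simp
  finally show ?thesis using True by (simp add: shatter_var_def)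
next
  case False
  have "s * k + (v - m) < Suc s * k" using False assms(3) by simp
  also have "\<dots> \<le> 2 ^ n * k" using assms(2) by (intro mult_le_mono1) simp
  finally show ?thesis using False by (simp add: shatter_var_def)
qed

lemma ex_bits:
  assumes "S \<subseteq> {..<n}"
  shows "\<exists>s<2 ^ n. \<forall>i<n. bit (s :: nat) i \<longleftrightarrow> i \<in> S"
proof -
  define s :: nat where "s = horner_sum of_bool 2 (map (\<lambda>i. i \<in> S) [0..<n])"
  have "bit s i \<longleftrightarrow> i \<in> S" if "i < n" for i
    using that by (simp add: s_def bit_horner_sum_bit_iff)
  moreover have "s < 2 ^ n"
    using horner_sum_of_bool_2_less[of "map (\<lambda>i. i \<in> S) [0..<n]", where ?'a = nat]
    by (simp add: s_def)
  ultimately show ?thesis by blast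
qed

lemma shatter_fm_in_theory_iff:
  assumes "wf_fm L \<phi>" "fv \<phi> \<subseteq> {..<m + k}"
  shows "shatter_fm m k n \<phi> \<in> complete_theory L M \<longleftrightarrow>
    (\<exists>a b. (\<forall>i<n. length (a i) = m) \<and> (\<forall>S\<subseteq>{..<n}. length (b S) = k) \<and>
           (\<forall>i<n. \<forall>S\<subseteq>{..<n}. holds M \<phi> (a i @ b S) \<longleftrightarrow> i \<in> S))"
    (is "_ \<longleftrightarrow> ?R")
proof -
  let ?N = "n * m + 2 ^ n * k"
  have wf: "wf_fm L (shatter_fm m k n \<phi>)"
    using assms(1) by (auto simp: shatter_fm_def wf_Ex_pow conj_simps Let_def wf_ren)
  have "fv (shatter_fm m k n \<phi>) = {}"
  proof -
    have "False" if "v + ?N \<in> fv (ren (shatter_var m k n i s) \<phi>)" "i < n" "s < 2 ^ n" for v i s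
    proof -
      from that(1) obtain w where "w \<in> fv \<phi>" "v + ?N = shatter_var m k n i s w"
        by (auto simp: fv_ren)
      with shatter_var_less[OF that(2,3), of w m k] assms(2) show False by auto
    qed
    then show ?thesis
      by (fastforce simp: shatter_fm_def fv_Ex_pow conj_simps Let_def split: if_splits)
  qed
  with wf have "shatter_fm m k n \<phi> \<in> complete_theory L M \<longleftrightarrow> (\<forall>e. sat M e (shatter_fm m k n \<phi>))"
    by (simp add: complete_theory_def)
  also have "\<dots> \<longleftrightarrow> (\<forall>e. \<exists>e'. (\<forall>v. e' (v + ?N) = e v) \<and>
      (\<forall>i<n. \<forall>s<2 ^ n. sat M (\<lambda>v. e' (shatter_var m k n i s v)) \<phi> \<longleftrightarrow> bit s i))"
    (is "_ \<longleftrightarrow> (\<forall>e. \<exists>e'. ?Q e e' \<and> ?P e')")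
    unfolding shatter_fm_def sat_Ex_pow conj_simps ball_grid
    by (intro all_cong1 ex_cong1 conj_cong refl) (auto simp: Let_def sat_ren)
  also have "\<dots> \<longleftrightarrow> ?R"
  proof
    assume "\<forall>e. \<exists>e'. ?Q e e' \<and> ?P e'"
    then obtain e' where e': "?P e'" by blast
    obtain c where c: "\<And>S. S \<subseteq> {..<n} \<Longrightarrow> c S < 2 ^ n \<and> (\<forall>i<n. bit (c S :: nat) i \<longleftrightarrow> i \<in> S)"
      using that[of "\<lambda>S. SOME s. s < 2 ^ n \<and> (\<forall>i<n. bit s i \<longleftrightarrow> i \<in> S)"] someI_ex[OF ex_bits] by blast
    define a where "a i = map (\<lambda>j. e' (i * m + j)) [0..<m]" for i
    define b where "b S = map (\<lambda>j. e' (n * m + c S * k + j)) [0..<k]" for S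
    have "holds M \<phi> (a i @ b S) \<longleftrightarrow> i \<in> S" if "i < n" "S \<subseteq> {..<n}" for i S
    proof -
      have "holds M \<phi> (a i @ b S) \<longleftrightarrow> sat M (\<lambda>v. e' (shatter_var m k n i (c S) v)) \<phi>"
        unfolding holds_def
      proof (rule sat_cong)
        fix v assume "v \<in> fv \<phi>"
        with assms(2) have "v < m + k" by auto
        then show "(a i @ b S) ! v = e' (shatter_var m k n i (c S) v)"
          by (auto simp: a_def b_def nth_append shatter_var_def simp del: add_diff_assoc)
      qed
      then show ?thesis using e' c[OF that(2)] that by blast
    qed
    moreover have "length (a i) = m" "length (b S) = k" for i S by (auto simp: a_def b_def)
    ultimately show ?R by blast
  next
    assume ?R
    then obtain a b where "\<forall>i<n. length (a i) = m"
      and "\<forall>S\<subseteq>{..<n}. length (b S) = k"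
      and *: "\<forall>i<n. \<forall>S\<subseteq>{..<n}. holds M \<phi> (a i @ b S) \<longleftrightarrow> i \<in> S"
      by (elim exE conjE)
    then have la: "length (a i) = m" if "i < n" for i using that by blast
    have ab: "holds M \<phi> (a i @ b S) \<longleftrightarrow> i \<in> S" if "i < n" "S \<subseteq> {..<n}" for i S
      using * that by blast
    show "\<forall>e. \<exists>e'. ?Q e e' \<and> ?P e'"
    proof
      fix e :: "nat \<Rightarrow> 'c"
      define S where "S s = {i. i < n \<and> bit (s :: nat) i}" for s
      define e' where "e' v =
        (if v < n * m then a (v div m) ! (v mod m)
         else if v < ?N then b (S ((v - n * m) div k)) ! ((v - n * m) mod k)
         else e (v - ?N))" for v
      have "?Q e e'" by (simp add: e'_def)
      moreover have "sat M (\<lambda>v. e' (shatter_var m k n i s v)) \<phi> \<longleftrightarrow> bit s i"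
        if il: "i < n" "s < 2 ^ n" for i s
      proof -
        have "e' (shatter_var m k n i s v) = (a i @ b (S s)) ! v" if "v \<in> fv \<phi>" for v
        proof -
          from that assms(2) have v: "v < m + k" by auto
          note less = shatter_var_less[OF il v]
          show ?thesis
          proof (cases "v < m")
            case True
            have "i * m + v < Suc i * m" using True by simp
            also have "\<dots> \<le> n * m" using il(1) by (intro mult_le_mono1) simp
            finally show ?thesis using True la[OF il(1)]
              by (simp add: shatter_var_def e'_def nth_append)
          next
            case False
            then obtain w where w: "v = m + w" "w < k"
              using v by (metis add_less_cancel_left le_Suc_ex not_less)
            then have "(s * k + w) div k = s" "(s * k + w) mod k = w" by simp_all
            moreover have "shatter_var m k n i s v = n * m + (s * k + w)"
              using w by (simp add: shatter_var_def)
            ultimately show ?thesis using less la[OF il(1)] w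
              by (simp add: e'_def nth_append)
          qed
        qed
        then have "sat M (\<lambda>v. e' (shatter_var m k n i s v)) \<phi> \<longleftrightarrow> holds M \<phi> (a i @ b (S s))"
          unfolding holds_def by (rule sat_cong)
        also have "\<dots> \<longleftrightarrow> bit s i" using ab[OF il(1), of "S s"] il(1) by (auto simp: S_def)
        finally show ?thesis .
      qed
      ultimately show "\<exists>e'. ?Q e e' \<and> ?P e'" by (intro exI[of _ e'] conjI) simp_all
    qed
  qed
  finally show ?thesis .
qed


section \<open>Definable sets and topologies\<close>

text \<open>\<open>definable L M n X\<close>: \<open>X\<close> is a subset of \<open>M\<^sup>n\<close> definable with parameters (the list \<open>cs\<close>).\<close>

definition definable ::
    "('f, 'r) lang \<Rightarrow> ('a, 'f, 'r) fo_struct \<Rightarrow> nat \<Rightarrow> 'a list set \<Rightarrow> bool" where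
  "definable L M n X \<longleftrightarrow>
     (\<exists>\<phi> cs. wf_fm L \<phi> \<and> fv \<phi> \<subseteq> {..<n + length cs} \<and>
             X = {as. length as = n \<and> holds M \<phi> (as @ cs)})"

text \<open>Uniformly definable families \<open>(D\<^sub>b)\<^sub>b\<^sub>\<in>\<^sub>B\<close> of subsets of \<open>M\<close>, with definable \<open>B \<subseteq> M\<^sup>k\<close>.\<close>

definition uniformly_definable ::
    "('f, 'r) lang \<Rightarrow> ('a, 'f, 'r) fo_struct \<Rightarrow> 'a set set \<Rightarrow> bool" where
  "uniformly_definable L M \<F> \<longleftrightarrow>
     (\<exists>k D B. definable L M (Suc k) D \<and> definable L M k B \<and>
              \<F> = (\<lambda>b. {x. x # b \<in> D}) ` B)"

definition definable_topology ::
    "('f, 'r) lang \<Rightarrow> ('a, 'f, 'r) fo_struct \<Rightarrow> 'a topology \<Rightarrow> bool" where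
  "definable_topology L M \<tau> \<longleftrightarrow>
     (\<exists>\<B>. uniformly_definable L M \<B> \<and> openin \<tau> = arbitrary union_of (\<lambda>U. U \<in> \<B>))"


section \<open>Fields\<close>

definition field_expansion ::
    "('f, 'r) lang \<Rightarrow> ('a :: field, 'f, 'r) fo_struct \<Rightarrow> bool" where
  "field_expansion L M \<longleftrightarrow>
     (\<exists>p t. (p, 2) \<in> Funs L \<and> (t, 2) \<in> Funs L \<and>
            (\<forall>x y. Fun M p [x, y] = x + y) \<and> (\<forall>x y. Fun M t [x, y] = x * y))"

definition ring_topology :: "'a :: field topology \<Rightarrow> bool" where
  "ring_topology \<tau> \<longleftrightarrow>
     topspace \<tau> = UNIV \<and> Hausdorff_space \<tau> \<and> \<tau> \<noteq> discrete_topology UNIV \<and>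
     continuous_map (prod_topology \<tau> \<tau>) \<tau> (\<lambda>(x, y). x + y) \<and>
     continuous_map (prod_topology \<tau> \<tau>) \<tau> (\<lambda>(x, y). x - y) \<and>
     continuous_map (prod_topology \<tau> \<tau>) \<tau> (\<lambda>(x, y). x * y)"

definition field_topology :: "'a :: field topology \<Rightarrow> bool" where
  "field_topology \<tau> \<longleftrightarrow>
     ring_topology \<tau> \<and>
     continuous_map (subtopology (prod_topology \<tau> \<tau>) {(x, y). y \<noteq> 0}) \<tau> (\<lambda>(x, y). x / y)"

end

theory Submission
  imports Defs
begin

text \<open>
  Suppose that inversion is not continuous at \<open>1\<close>: some neighbourhood \<open>N\<^sub>0\<close> of \<open>1\<close> misses the inverses
  of elements \<open>a = 1 + x\<close> with \<open>x \<noteq> -1\<close> arbitrarily close to \<open>0\<close>. Choose such bad elements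
  \<open>a\<^sub>0, a\<^sub>1, \<dots>\<close> one after the other, each extremely close to \<open>1\<close> compared with its predecessors, and
  put \<open>P\<^sub>S = (\<Prod>j\<in>S. a\<^sub>j)\<close>. Let \<open>N\<close> be a neighbourhood of \<open>1\<close> such that \<open>1 - u * z \<in> N\<^sub>0\<close> for
  all \<open>u\<close> near \<open>0\<close> and all \<open>z\<close> in the closure of \<open>N\<close>. Then whether \<open>P\<^sub>S / a\<^sub>i\<close> lies in \<open>N\<close> detects
  whether \<open>i \<in> S\<close>. If \<open>i \<in> S\<close>, the quotient is a product of elements very close to \<open>1\<close>, hence in
  \<open>N\<close>. If \<open>i \<notin> S\<close>, suppose first that all elements of \<open>S\<close> are below \<open>i\<close>. The element
  \<open>x\<^sub>i = a\<^sub>i - 1\<close> was chosen so small that \<open>u = x\<^sub>i / P\<^sub>S\<close> is small as well, and so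
  \<open>1 / a\<^sub>i = 1 - u * (P\<^sub>S / a\<^sub>i)\<close> would be in \<open>N\<^sub>0\<close> if \<open>P\<^sub>S / a\<^sub>i\<close> were in the closure of \<open>N\<close>. Later
  factors \<open>a\<^sub>j\<close> move the quotient too little to bring it into \<open>N\<close>.

  Intuitively, the bad elements behave like pairwise comaximal non-units of a ring, and a product of
  some of them is divisible by no other.
  When \<open>N\<close> is taken from a definable basis, the formula expressing \<open>y / x \<in> N\<close> therefore shatters sets
  of every finite size (\<open>bad_inverses_shatter\<close>), contradicting NIP (\<open>NIP_quotient_not_shattered\<close>).
  Hence inversion is continuous at \<open>1\<close>, and by homogeneity division is continuous
  (\<open>field_topologyI\<close>).
\<close>

section \<open>Ring topologies\<close>

lemma ring_topology_affine:
  assumes "ring_topology \<tau>"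
  shows "continuous_map \<tau> \<tau> (\<lambda>x. c * x + d)"
proof -
  have c: "continuous_map \<tau> \<tau> (\<lambda>x. c)" for c
    using assms by (simp add: ring_topology_def)
  have "continuous_map \<tau> (prod_topology \<tau> \<tau>) (\<lambda>x. (c, x))"
    using c by (simp add: continuous_map_paired)
  then have "continuous_map \<tau> \<tau> (\<lambda>x. c * x)"
    using continuous_map_compose[of \<tau> "prod_topology \<tau> \<tau>" "\<lambda>x. (c, x)" \<tau> "\<lambda>(x, y). x * y"] assms
    by (simp add: ring_topology_def comp_def)
  then have "continuous_map \<tau> (prod_topology \<tau> \<tau>) (\<lambda>x. (c * x, d))"
    using c by (simp add: continuous_map_paired)
  then show ?thesis
    using continuous_map_compose[of \<tau> "prod_topology \<tau> \<tau>" "\<lambda>x. (c * x, d)" \<tau> "\<lambda>(x, y). x + y"] assms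
    by (simp add: ring_topology_def comp_def)
qed

lemma openin_affine_vimage:
  assumes "ring_topology \<tau>" "openin \<tau> U"
  shows "openin \<tau> {x. c * x + d \<in> U}"
  using openin_continuous_map_preimage[OF ring_topology_affine[OF assms(1)] assms(2)] assms(1)
  by (simp add: ring_topology_def)

lemma openin_prod_topology_nhds:
  assumes "continuous_map (prod_topology \<tau> \<tau>) \<tau> f" "topspace \<tau> = UNIV" "openin \<tau> U" "f (a, b) \<in> U"
  obtains A B where "openin \<tau> A" "openin \<tau> B" "a \<in> A" "b \<in> B"
    "\<And>x y. x \<in> A \<Longrightarrow> y \<in> B \<Longrightarrow> f (x, y) \<in> U"
proof -
  have "openin (prod_topology \<tau> \<tau>) {p. f p \<in> U}"
    using openin_continuous_map_preimage[OF assms(1,3)] assms(2) by simp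
  then obtain A B where "openin \<tau> A" "openin \<tau> B" "a \<in> A" "b \<in> B" "A \<times> B \<subseteq> {p. f p \<in> U}"
    unfolding openin_prod_topology_alt using assms(4) by (metis mem_Collect_eq)
  then show ?thesis by (intro that[of A B]) auto
qed

text \<open>
  Ring topologies are regular, as all group topologies: if \<open>A - B \<subseteq> U\<close> for a neighbourhood \<open>B\<close> of
  \<open>0\<close>, then the closure of \<open>A\<close> lies in \<open>U\<close>.
\<close>

lemma ring_topology_regular:
  assumes "ring_topology \<tau>" "openin \<tau> U" "a \<in> U"
  obtains A where "openin \<tau> A" "a \<in> A" "\<tau> closure_of A \<subseteq> U"
proof -
  have "continuous_map (prod_topology \<tau> \<tau>) \<tau> (\<lambda>(x, y). x - y)" "topspace \<tau> = UNIV"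
    using assms(1) by (simp_all add: ring_topology_def)
  then obtain A B where AB: "openin \<tau> A" "openin \<tau> B" "a \<in> A" "0 \<in> B"
      "\<And>x y. x \<in> A \<Longrightarrow> y \<in> B \<Longrightarrow> x - y \<in> U"
    using openin_prod_topology_nhds[of \<tau> "\<lambda>(x, y). x - y" U a 0] assms(2,3) by auto
  have "z \<in> U" if "z \<in> \<tau> closure_of A" for z
  proof -
    let ?T = "{t. 1 * t + (- z) \<in> B}"
    have "openin \<tau> ?T"
      by (rule openin_affine_vimage[OF assms(1) AB(2)])
    moreover have "z \<in> ?T" using AB(4) by simp
    ultimately have "\<exists>t. t \<in> A \<and> t \<in> ?T"
      using conjunct2[OF that[unfolded in_closure_of], THEN spec, of ?T] by simp
    then obtain t where "t \<in> A" "t - z \<in> B" by auto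
    then show ?thesis using AB(5)[of t "t - z"] by simp
  qed
  then show ?thesis by (intro that[OF AB(1,3)] subsetI)
qed

text \<open>Multiplicative translations move continuity of inversion from \<open>1\<close> to every \<open>y \<noteq> 0\<close>.\<close>

lemma field_topologyI:
  assumes rt: "ring_topology \<tau>"
    and inv1: "\<And>N. openin \<tau> N \<Longrightarrow> 1 \<in> N \<Longrightarrow> \<exists>Q. openin \<tau> Q \<and> 0 \<in> Q \<and> (\<forall>x\<in>Q. 1 / (1 + x) \<in> N)"
  shows "field_topology \<tau>"
proof -
  have top: "topspace \<tau> = UNIV" using rt by (simp add: ring_topology_def)
  have inv: "continuous_map (subtopology \<tau> {y. y \<noteq> 0}) \<tau> inverse"
    unfolding continuous_map_eq_topcontinuous_at topcontinuous_at_def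
  proof (intro ballI conjI allI impI)
    fix y V assume y: "y \<in> topspace (subtopology \<tau> {y. y \<noteq> 0})" and V: "openin \<tau> V \<and> inverse y \<in> V"
    then have y0: "y \<noteq> 0" by simp
    let ?N = "{z. inverse y * z + 0 \<in> V}"
    have openN: "openin \<tau> ?N" by (rule openin_affine_vimage[OF rt conjunct1[OF V]])
    have "1 \<in> ?N" using V by simp
    from inv1[OF openN this] obtain Q
      where "openin \<tau> Q \<and> 0 \<in> Q \<and> (\<forall>x\<in>Q. 1 / (1 + x) \<in> ?N)" by (rule exE)
    then have Q: "openin \<tau> Q" "0 \<in> Q" "\<And>x. x \<in> Q \<Longrightarrow> 1 / (1 + x) \<in> ?N" by simp_all
    let ?U = "{t. inverse y * t + (- 1) \<in> Q} \<inter> {y. y \<noteq> 0}"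
    have "inverse t \<in> V" if t: "t \<in> ?U" for t
    proof -
      have "1 / (1 + (inverse y * t + (- 1))) \<in> ?N" by (rule Q(3)) (use t in simp)
      moreover have "inverse y * (1 / (1 + (inverse y * t + (- 1)))) + 0 = inverse t"
        using y0 by (simp add: divide_inverse)
      ultimately show ?thesis by simp
    qed
    moreover have "openin (subtopology \<tau> {y. y \<noteq> 0}) ?U"
      by (intro openin_subtopology_Int openin_affine_vimage[OF rt Q(1)])
    moreover have "y \<in> ?U"
      using y0 Q(2) by simp
    ultimately show "\<exists>U. openin (subtopology \<tau> {y. y \<noteq> 0}) U \<and> y \<in> U \<and> (\<forall>t\<in>U. inverse t \<in> V)"
      by (intro exI[of _ ?U] conjI ballI)
  qed (simp_all add: top)
  let ?D = "subtopology (prod_topology \<tau> \<tau>) {(x, y). y \<noteq> 0}"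
  have fst: "continuous_map ?D \<tau> fst" and snd: "continuous_map ?D \<tau> snd"
    by (intro continuous_map_from_subtopology continuous_map_fst continuous_map_snd)+
  have "continuous_map ?D (subtopology \<tau> {y. y \<noteq> 0}) snd"
    unfolding continuous_map_in_subtopology using snd by auto
  from continuous_map_compose[OF this inv] have "continuous_map ?D \<tau> (\<lambda>p. inverse (snd p))"
    by (simp only: comp_def)
  with fst have "continuous_map ?D (prod_topology \<tau> \<tau>) (\<lambda>p. (fst p, inverse (snd p)))"
    by (simp add: continuous_map_paired)
  then have "continuous_map ?D \<tau> ((\<lambda>(x, y). x * y) \<circ> (\<lambda>p. (fst p, inverse (snd p))))"
    using rt by (intro continuous_map_compose) (auto simp: ring_topology_def)
  then show ?thesis
    using rt by (simp add: field_topology_def comp_def case_prod_unfold divide_inverse)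
qed


section \<open>Products of elements with bad inverses\<close>

text \<open>
  The elements \<open>a i = 1 + x\<close> are chosen one after the other with \<open>1 / a i \<notin> N\<^sub>0\<close>. For the induction,
  the quotients with \<open>i \<notin> S\<close> avoid the closure of \<open>N\<close>, not just \<open>N\<close>: this is an open condition, which
  survives multiplication by a new factor close to \<open>1\<close>. The products \<open>prod a S\<close> themselves are kept
  in \<open>N\<close> since they are the quotients \<open>prod a (insert n S) / a n\<close> of the next step.
\<close>

lemma bad_inverses_shatter:
  fixes \<tau> :: "'k :: field topology" and n :: nat
  assumes rt: "ring_topology \<tau>"
    and N: "openin \<tau> N" "1 \<in> N"
    and W: "openin \<tau> W" "0 \<in> W" "\<And>u z. u \<in> W \<Longrightarrow> z \<in> \<tau> closure_of N \<Longrightarrow> 1 - u * z \<in> N\<^sub>0"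
    and bad: "\<And>Q. openin \<tau> Q \<Longrightarrow> 0 \<in> Q \<Longrightarrow> \<exists>x\<in>Q. 1 / (1 + x) \<notin> N\<^sub>0"
  shows "\<exists>a :: nat \<Rightarrow> 'k. (\<forall>i<n. a i \<noteq> 0) \<and> (\<forall>S\<subseteq>{..<n}. prod a S \<in> N \<and>
    (\<forall>i<n. (i \<in> S \<longrightarrow> prod a S / a i \<in> N) \<and> (i \<notin> S \<longrightarrow> prod a S / a i \<notin> \<tau> closure_of N)))"
proof (induction n)
  case 0
  show ?case using N by auto
next
  case (Suc n)
  have top: "topspace \<tau> = UNIV" using rt by (simp add: ring_topology_def)
  from Suc.IH obtain a :: "nat \<Rightarrow> 'k" where a: "\<And>i. i < n \<Longrightarrow> a i \<noteq> 0"
    and aN: "\<And>S. S \<subseteq> {..<n} \<Longrightarrow> prod a S \<in> N"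
    and a_in: "\<And>S i. S \<subseteq> {..<n} \<Longrightarrow> i < n \<Longrightarrow> i \<in> S \<Longrightarrow> prod a S / a i \<in> N"
    and a_out: "\<And>S i. S \<subseteq> {..<n} \<Longrightarrow> i < n \<Longrightarrow> i \<notin> S \<Longrightarrow> prod a S / a i \<notin> \<tau> closure_of N"
    by blast
  let ?C = "UNIV - \<tau> closure_of N"
  have C: "openin \<tau> ?C" using openin_diff[OF openin_topspace closedin_closure_of] top by metis
  have P0: "prod a S \<noteq> 0" if "S \<subseteq> {..<n}" for S
    using that a finite_subset[OF that] by (subst prod_zero_iff) auto
  define q where "q S i = prod a S / a i" for S i
  \<comment> \<open>The smallness conditions on \<open>x\<close>: it differs from \<open>-1\<close>, its quotients by the products are in
    \<open>W\<close>, and the factor \<open>1 + x\<close> destroys none of the finitely many open conditions obtained so far.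
    All of them are open and hold for \<open>x = 0\<close>.\<close>
  define E where "E S = {x. (1 / prod a S) * x + 0 \<in> W} \<inter> {x. prod a S * x + prod a S \<in> N}" for S
  define F where "F S i = {x. q S i * x + q S i \<in> (if i \<in> S then N else ?C)}" for S i
  define Q where "Q = (UNIV - {- 1}) \<inter> (\<Inter>S\<in>Pow {..<n}. E S) \<inter>
      (\<Inter>p\<in>Pow {..<n} \<times> {..<n}. F (fst p) (snd p))"
  have Fo: "openin \<tau> (F S i)" "openin \<tau> (E S)" for S i
    unfolding E_def F_def
    by (intro openin_Int openin_affine_vimage[OF rt]; use N W C in simp)+
  have "0 \<in> F S i" if "S \<subseteq> {..<n}" "i < n" for S i
    using a_in[OF that] a_out[OF that] by (auto simp: F_def q_def)
  moreover have "0 \<in> E S" if "S \<subseteq> {..<n}" for S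
    using W(2) aN[OF that] by (auto simp: E_def)
  ultimately have Q0: "0 \<in> Q" by (auto simp: Q_def)
  have "closedin \<tau> {- 1}"
    using rt by (simp add: ring_topology_def closedin_Hausdorff_sing_eq)
  then have "openin \<tau> (UNIV - {- 1})" using top by (metis openin_diff openin_topspace)
  then have "openin \<tau> Q"
    unfolding Q_def
    by (cases "n = 0") (auto intro!: Fo)
  then obtain x where x: "x \<in> Q" "1 / (1 + x) \<notin> N\<^sub>0" using bad Q0 by blast
  define a' where "a' = a(n := 1 + x)"
  have a'_n: "a' n = 1 + x" and a'_less: "i < n \<Longrightarrow> a' i = a i" for i
    by (simp_all add: a'_def)
  have x1: "1 + x \<noteq> 0" using x(1) by (auto simp: Q_def add_eq_0_iff)
  have xE: "x / prod a S \<in> W" "prod a S * (1 + x) \<in> N" if "S \<subseteq> {..<n}" for S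
    using x(1) that by (auto simp: Q_def E_def algebra_simps)
  have xF: "q S i * (1 + x) \<in> (if i \<in> S then N else ?C)" if "S \<subseteq> {..<n}" "i < n" for S i
    using x(1) that by (auto simp: Q_def F_def algebra_simps split: if_splits)
  have prod_a': "prod a' S = (if n \<in> S then prod a (S - {n}) * (1 + x) else prod a S)"
    if "S \<subseteq> {..<Suc n}" for S
  proof -
    have "finite S" using that finite_subset by blast
    have "prod a' (S - {n}) = prod a (S - {n})" by (rule prod.cong) (auto simp: a'_def)
    then show ?thesis
      using prod.remove[OF \<open>finite S\<close>, of n a'] by (cases "n \<in> S") (auto simp: a'_n mult.commute)
  qed
  have new: "prod a S / (1 + x) \<notin> \<tau> closure_of N" if "S \<subseteq> {..<n}" for S
  proof
    assume "prod a S / (1 + x) \<in> \<tau> closure_of N"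
    from W(3)[OF xE(1)[OF that] this] have "1 - x / (1 + x) \<in> N\<^sub>0" using P0[OF that] by simp
    moreover have "1 - x / (1 + x) = 1 / (1 + x)" using x1 by (simp add: field_simps)
    ultimately show False using x(2) by simp
  qed
  have main: "prod a' S \<in> N \<and> (i \<in> S \<longrightarrow> prod a' S / a' i \<in> N) \<and>
      (i \<notin> S \<longrightarrow> prod a' S / a' i \<notin> \<tau> closure_of N)"
    if S: "S \<subseteq> {..<Suc n}" and i: "i < Suc n" for S i
  proof (cases "n \<in> S")
    case True
    have S': "S - {n} \<subseteq> {..<n}" using S by auto
    show ?thesis
    proof (cases "i = n")
      case True
      then show ?thesis using \<open>n \<in> S\<close> x1 xE(2)[OF S'] aN[OF S'] by (simp add: prod_a'[OF S] a'_n)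
    next
      case False
      then have "i < n" using i by simp
      from xF[OF S' this] False show ?thesis using \<open>n \<in> S\<close> xE(2)[OF S']
        by (auto simp: prod_a'[OF S] a'_less \<open>i < n\<close> q_def)
    qed
  next
    case False
    then have S': "S \<subseteq> {..<n}" using S by (auto simp: less_Suc_eq)
    show ?thesis
    proof (cases "i = n")
      case True
      then show ?thesis using False aN[OF S'] new[OF S'] by (simp add: prod_a'[OF S] a'_n)
    next
      case False
      then have "i < n" using i by simp
      then show ?thesis using \<open>n \<notin> S\<close> False aN[OF S'] a_in[OF S'] a_out[OF S']
        by (simp add: prod_a'[OF S] a'_less)
    qed
  qed
  have "\<forall>i<Suc n. a' i \<noteq> 0" using a x1 by (auto simp: a'_def less_Suc_eq)
  moreover have "\<forall>S\<subseteq>{..<Suc n}. prod a' S \<in> N \<and> (\<forall>i<Suc n. (i \<in> S \<longrightarrow> prod a' S / a' i \<in> N) \<and>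
      (i \<notin> S \<longrightarrow> prod a' S / a' i \<notin> \<tau> closure_of N))"
    using main by blast
  ultimately show ?case by blast
qed


section \<open>NIP and definable bases\<close>

text \<open>
  Division is not a function symbol of the language, so the formula used is
  \<open>\<exists>z. z * x = y \<and> z \<in> N\<close>, in the object variable \<open>x\<close>. The parameters that define \<open>N\<close> are appended
  to \<open>y\<close> as further parameter variables, so that NIP applies to a formula without parameters.
\<close>

lemma NIP_quotient_not_shattered:
  fixes M :: "('k :: field, 'f, 'r) fo_struct"
  assumes fe: "field_expansion L M" and nip: "NIP L (complete_theory L M)"
    and ud: "uniformly_definable L M \<B>" and NB: "N \<in> \<B>"
  shows "\<exists>n :: nat. \<nexists>a y. (\<forall>i<n. a i \<noteq> 0) \<and> (\<forall>S\<subseteq>{..<n}. \<forall>i<n. y S / a i \<in> N \<longleftrightarrow> i \<in> S)"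
proof -
  from fe obtain t where t: "(t, 2) \<in> Funs L" "\<And>x y. Fun M t [x, y] = x * y"
    by (auto simp: field_expansion_def)
  from ud obtain k D B where "definable L M (Suc k) D" "definable L M k B"
      and BD: "\<B> = (\<lambda>b. {x. x # b \<in> D}) ` B"
    by (auto simp: uniformly_definable_def)
  then obtain \<phi> cs where \<phi>: "wf_fm L \<phi>" "fv \<phi> \<subseteq> {..<Suc k + length cs}"
      and D: "D = {as. length as = Suc k \<and> holds M \<phi> (as @ cs)}"
      and lB: "\<And>b. b \<in> B \<Longrightarrow> length b = k"
    by (auto simp: definable_def)
  from NB BD obtain b where b: "b \<in> B" "N = {x. x # b \<in> D}" by blast
  have N: "z \<in> N \<longleftrightarrow> holds M \<phi> (z # b @ cs)" for z
    using b lB D by simp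
  \<comment> \<open>Below the quantifier, the variables \<open>0\<close>, \<open>1\<close>, \<open>2\<close> are \<open>z\<close>, \<open>x\<close>, \<open>y\<close>, and the parameters of
    \<open>\<phi>\<close> start at \<open>3\<close>.\<close>
  define \<rho> where "\<rho> = case_nat 0 (\<lambda>j. j + 3)"
  define \<psi> where "\<psi> = FEx (FAnd (FEq (App t [Var 0, Var 1]) (Var 2)) (ren \<rho> \<phi>))"
  let ?K = "1 + length (b @ cs)"
  have wf: "wf_fm L \<psi>" using \<phi>(1) t(1) by (simp add: \<psi>_def wf_ren numeral_2_eq_2)
  have fv: "fv \<psi> \<subseteq> {..<1 + ?K}"
    using \<phi>(2) lB[OF b(1)] by (force simp: \<psi>_def fv_ren \<rho>_def split: nat.splits)
  have holds_\<psi>: "holds M \<psi> ([x] @ (y # b @ cs)) \<longleftrightarrow> y / x \<in> N" if "x \<noteq> 0" for x y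
  proof -
    have "holds M \<psi> ([x] @ (y # b @ cs)) \<longleftrightarrow>
        (\<exists>z. z * x = y \<and> sat M (\<lambda>v. case_nat z ((!) (x # y # b @ cs)) (\<rho> v)) \<phi>)"
      by (simp add: holds_def \<psi>_def t(2) sat_ren numeral_2_eq_2)
    moreover have "(\<lambda>v. case_nat z ((!) (x # y # b @ cs)) (\<rho> v)) = (!) (z # b @ cs)" for z
      by (auto simp: \<rho>_def fun_eq_iff numeral_3_eq_3 split: nat.splits)
    moreover have "(\<exists>z. z * x = y \<and> sat M ((!) (z # b @ cs)) \<phi>) \<longleftrightarrow> y / x \<in> N"
      using that by (auto simp: N holds_def intro!: exI[of _ "y / x"])
    ultimately show ?thesis by simp
  qed
  have "\<not> has_IP (complete_theory L M) 1 ?K \<psi>"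
    using nip wf fv unfolding NIP_def by metis
  then obtain n where n: "shatter_fm 1 ?K n \<psi> \<notin> complete_theory L M"
    unfolding has_IP_def not_all by (rule exE)
  have False if a: "\<forall>i<n. a i \<noteq> 0" "\<forall>S\<subseteq>{..<n}. \<forall>i<n. y S / a i \<in> N \<longleftrightarrow> i \<in> S" for a y
  proof -
    have "\<exists>a b. (\<forall>i<n. length (a i) = 1) \<and> (\<forall>S\<subseteq>{..<n}. length (b S) = ?K) \<and>
           (\<forall>i<n. \<forall>S\<subseteq>{..<n}. holds M \<psi> (a i @ b S) \<longleftrightarrow> i \<in> S)"
    proof (intro exI conjI)
      show "\<forall>i<n. \<forall>S\<subseteq>{..<n}. holds M \<psi> ([a i] @ (y S # b @ cs)) \<longleftrightarrow> i \<in> S"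
        using a holds_\<psi> by simp
    qed simp_all
    then show False using n by (subst (asm) shatter_fm_in_theory_iff[OF wf fv]) (rule notE)
  qed
  then have "\<nexists>a y. (\<forall>i<n. a i \<noteq> 0) \<and> (\<forall>S\<subseteq>{..<n}. \<forall>i<n. y S / a i \<in> N \<longleftrightarrow> i \<in> S)"
    by (intro notI) (elim exE conjE, assumption)
  then show ?thesis by (rule exI)
qed


section \<open>Continuity of division\<close>

theorem corollary1p5:
  fixes L :: "('f, 'r) lang"
    and M :: "('k :: field, 'f, 'r) fo_struct"
    and \<tau> :: "'k topology"
  assumes "field_expansion L M"
    and "NIP L (complete_theory L M)"
    and "ring_topology \<tau>"
    and "definable_topology L M \<tau>"
  shows "field_topology \<tau>"
proof (rule field_topologyI[OF assms(3)], rule ccontr)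
  fix N\<^sub>0 assume N0: "openin \<tau> N\<^sub>0" "1 \<in> N\<^sub>0"
    and "\<nexists>Q. openin \<tau> Q \<and> 0 \<in> Q \<and> (\<forall>x\<in>Q. 1 / (1 + x) \<in> N\<^sub>0)"
  then have bad: "\<And>Q. openin \<tau> Q \<Longrightarrow> 0 \<in> Q \<Longrightarrow> \<exists>x\<in>Q. 1 / (1 + x) \<notin> N\<^sub>0" by blast
  have mult: "continuous_map (prod_topology \<tau> \<tau>) \<tau> (\<lambda>(x, y). x * y)" and top: "topspace \<tau> = UNIV"
    using assms(3) by (simp_all add: ring_topology_def)
  have "openin \<tau> {x. (- 1) * x + 1 \<in> N\<^sub>0}" by (rule openin_affine_vimage[OF assms(3) N0(1)])
  then obtain W N' where W: "openin \<tau> W" "0 \<in> W" and N': "openin \<tau> N'" "1 \<in> N'"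
      and WN': "\<And>u z. u \<in> W \<Longrightarrow> z \<in> N' \<Longrightarrow> (- 1) * (u * z) + 1 \<in> N\<^sub>0"
    by (rule openin_prod_topology_nhds[OF mult top, of "{x. (- 1) * x + 1 \<in> N\<^sub>0}" 0 1])
      (use N0(2) in auto)
  obtain A where A: "openin \<tau> A" "1 \<in> A" "\<tau> closure_of A \<subseteq> N'"
    using ring_topology_regular[OF assms(3) N'] by blast
  from assms(4) obtain \<B> where \<B>: "uniformly_definable L M \<B>"
      "openin \<tau> = arbitrary union_of (\<lambda>U. U \<in> \<B>)"
    by (auto simp: definable_topology_def)
  obtain N where N: "N \<in> \<B>" "1 \<in> N" "N \<subseteq> A"
    using A(1,2) unfolding \<B>(2) arbitrary_union_of_alt by blast
  have oN: "openin \<tau> N"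
    unfolding \<B>(2) using N(1) by (intro union_of_inc) (simp_all add: arbitrary_def)
  have cN: "\<tau> closure_of N \<subseteq> N'" using closure_of_mono[OF N(3)] A(3) by blast
  obtain n :: nat where n: "\<nexists>a y. (\<forall>i<n. a i \<noteq> 0) \<and> (\<forall>S\<subseteq>{..<n}. \<forall>i<n. y S / a i \<in> N \<longleftrightarrow> i \<in> S)"
    using NIP_quotient_not_shattered[OF assms(1,2) \<B>(1) N(1)] by blast
  have "1 - u * z \<in> N\<^sub>0" if "u \<in> W" "z \<in> \<tau> closure_of N" for u z
    using WN'[of u z] that cN by auto
  from bad_inverses_shatter[OF assms(3) oN N(2) W this bad, of n] obtain a :: "nat \<Rightarrow> 'k" where
    a: "(\<forall>i<n. a i \<noteq> 0) \<and> (\<forall>S\<subseteq>{..<n}. prod a S \<in> N \<and> (\<forall>i<n.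
      (i \<in> S \<longrightarrow> prod a S / a i \<in> N) \<and> (i \<notin> S \<longrightarrow> prod a S / a i \<notin> \<tau> closure_of N)))"
    by (rule exE)
  have "N \<subseteq> \<tau> closure_of N" using closure_of_subset[of N \<tau>] top by simp
  with a have "prod a S / a i \<in> N \<longleftrightarrow> i \<in> S" if "S \<subseteq> {..<n}" "i < n" for S i
    using that by (meson subsetD)
  with a have "(\<forall>i<n. a i \<noteq> 0) \<and> (\<forall>S\<subseteq>{..<n}. \<forall>i<n. prod a S / a i \<in> N \<longleftrightarrow> i \<in> S)" by simp
  then have "\<exists>a y. (\<forall>i<n. a i \<noteq> 0) \<and> (\<forall>S\<subseteq>{..<n}. \<forall>i<n. y S / a i \<in> N \<longleftrightarrow> i \<in> S)"
    by (intro exI[of _ a] exI[of _ "prod a"])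
  with n show False by (rule notE)
qed

end
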